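(* For all $k\geq 1$, $AR_o^*(M_k) \leq \frac{k^2}{3} + \mathcal{O}(k)$; that is, there is an absolute constant $C$ such that $AR_o^*(M_k) \leq \frac{k^2}{3} + Ck$ for all $k\geq 1$, where $M_k$ is the matching with $k$ edges.
   Context: An edge-coloring (with natural numbers as colors) of a graph, possibly with parallel edges, is proper if any two distinct edges sharing an endpoint (in particular parallel edges) receive distinct colors; an edge-colored graph is rainbow if all its edges have distinct colors. A copy of $H$ is a (not necessarily induced) subgraph isomorphic to $H$. $AR_o^*(H)$ is defined by a game between Builder and Painter: Builder creates vertices and edges, one edge at a time, and is allowed to present parallel edges; immediately after each edge is built, Painter irrevocably colors it so that the coloring stays proper. Both players have complete information. $AR_o^*(H)$ is the smallest $t$ such that Builder has a strategy which, against every Painter, guarantees a rainbow copy of $H$ after at most $t$ edges have been built and colored. *)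

theory Defs
  imports Complex_Main "HOL-Library.Extended_Real"
begin

text \<open>
  A simple graph is a pair of a vertex set and a set of two-element edges.
\<close>

type_synonym 'a sgraph = "'a set \<times> 'a set set"

definition matching_graph :: "nat \<Rightarrow> nat sgraph" where
  "matching_graph k = ({..<2 * k}, {{2 * i, 2 * i + 1} |i. i < k})"

text \<open>
  A board lists the edges built so far, in order, each with its colour. The identity of an
  edge is its position in the list, so entries with the same endpoints are parallel edges.
  Creating vertices costs nothing; the vertices available to Builder are the natural numbers.
\<close>

type_synonym board = "(nat set \<times> nat) list"

definition ends :: "board \<Rightarrow> nat \<Rightarrow> nat set" where
  "ends G i = fst (G ! i)"

definition colour :: "board \<Rightarrow> nat \<Rightarrow> nat" where
  "colour G i = snd (G ! i)"

definition is_edge :: "nat set \<Rightarrow> bool" where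
  "is_edge e \<longleftrightarrow> card e = 2"

definition proper :: "board \<Rightarrow> bool" where
  "proper G \<longleftrightarrow>
     (\<forall>i < length G. \<forall>j < length G.
        i \<noteq> j \<and> ends G i \<inter> ends G j \<noteq> {} \<longrightarrow> colour G i \<noteq> colour G j)"

text \<open>
  The subgraph of \<open>G\<close> with vertex set \<open>W\<close> and edges at the positions in \<open>F\<close> is isomorphic to
  the simple graph \<open>H\<close>.
\<close>

definition is_copy :: "'a sgraph \<Rightarrow> board \<Rightarrow> nat set \<Rightarrow> nat set \<Rightarrow> bool" where
  "is_copy H G W F \<longleftrightarrow>
     F \<subseteq> {..<length G} \<and> (\<forall>i\<in>F. ends G i \<subseteq> W) \<and>
     (\<exists>f g. bij_betw f (fst H) W \<and> bij_betw g (snd H) F \<and>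
            (\<forall>e\<in>snd H. ends G (g e) = f ` e))"

definition rainbow :: "board \<Rightarrow> nat set \<Rightarrow> bool" where
  "rainbow G F \<longleftrightarrow> inj_on (colour G) F"

definition has_rainbow_copy :: "'a sgraph \<Rightarrow> board \<Rightarrow> bool" where
  "has_rainbow_copy H G \<longleftrightarrow> (\<exists>W F. is_copy H G W F \<and> rainbow G F)"

type_synonym builder = "board \<Rightarrow> nat set"
type_synonym painter = "board \<Rightarrow> nat set \<Rightarrow> nat"

definition legal_builder :: "builder \<Rightarrow> bool" where
  "legal_builder B \<longleftrightarrow> (\<forall>G. is_edge (B G))"

definition legal_painter :: "painter \<Rightarrow> bool" where
  "legal_painter P \<longleftrightarrow>
     (\<forall>G e. proper G \<and> is_edge e \<longrightarrow> proper (G @ [(e, P G e)]))"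

primrec play :: "builder \<Rightarrow> painter \<Rightarrow> nat \<Rightarrow> board" where
  "play B P 0 = []"
| "play B P (Suc n) =
     (let G = play B P n; e = B G in G @ [(e, P G e)])"

definition builder_wins_within :: "'a sgraph \<Rightarrow> nat \<Rightarrow> bool" where
  "builder_wins_within H t \<longleftrightarrow>
     (\<exists>B. legal_builder B \<and>
          (\<forall>P. legal_painter P \<longrightarrow> (\<exists>n\<le>t. has_rainbow_copy H (play B P n))))"

text \<open>The value is \<open>\<infinity>\<close> if Builder cannot force a rainbow copy in boundedly many steps.\<close>

definition AR_o_star :: "'a sgraph \<Rightarrow> enat" where
  "AR_o_star H = Inf {enat t |t. builder_wins_within H t}"

end

theory Submission
  imports Defs
begin

text \<open>
  Builder repeatedly enlarges a rainbow matching \<open>M\<close> with \<open>i\<close> edges, paying about \<open>2 i / 3\<close> edges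
  for each gained edge; summing over \<open>i\<close> yields \<open>k\<^sup>2 / 3\<close>. Put \<open>m = i div 3\<close> and call a colour new
  if it is not used on \<open>M\<close>. Builder draws \<open>m\<close> parallel edges on each side of a triangle \<open>u v w\<close>
  disjoint from \<open>M\<close>, in the order \<open>u v\<close>, \<open>v w\<close>, \<open>u w\<close>.

  A new colour on \<open>u v\<close> or \<open>v w\<close> gains one edge for at most \<open>2 m\<close> edges built. If the first
  new colour is on \<open>u w\<close>, then \<open>v\<close> already meets \<open>2 m\<close> colours of \<open>M\<close>, so about \<open>i - 2 m\<close>
  parallel pendant edges at \<open>v\<close> force another new colour: two edges are gained for about
  \<open>i + m\<close>. If the triangle shows no new colour, each of its three vertices meets \<open>2 m\<close> colours of
  \<open>M\<close>, and pendant edges at all three gain three edges for about \<open>3 m + 3 (i - 2 m)\<close>.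
\<close>

section \<open>Forcing a board property\<close>

text \<open>Builder's winning region as a least fixed point: Builder names an edge, and every colour
  that keeps the board proper must lead on to a winning board. No move bound is built in; edge
  counts are carried by \<open>Q\<close> through the length of the board.\<close>

inductive forces :: "(board \<Rightarrow> bool) \<Rightarrow> board \<Rightarrow> bool" for Q where
  forces_now: "Q G \<Longrightarrow> forces Q G"
| forces_step: "is_edge e \<Longrightarrow> (\<And>c. proper (G @ [(e, c)]) \<Longrightarrow> forces Q (G @ [(e, c)])) \<Longrightarrow> forces Q G"

text \<open>Sequential composition of strategies: once \<open>Q\<close> is reached, Builder
  continues from the board at hand.\<close>

lemma forces_bind:
  assumes "forces Q G" "proper G"
    and "\<And>G'. proper G' \<Longrightarrow> Q G' \<Longrightarrow> forces R G'"
  shows "forces R G"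
  using assms(1,2)
proof induction
  case (forces_now G)
  then show ?case using assms(3) by blast
next
  case (forces_step e G)
  then show ?case using forces.forces_step by blast
qed

lemma forces_mono:
  assumes "forces Q G" "proper G" "\<And>G'. Q G' \<Longrightarrow> R G'"
  shows "forces R G"
  using forces_bind[OF assms(1,2)] assms(3) forces_now by blast

text \<open>\<open>P\<close> supplies a proper answer at every step, so the quantification over
  colours is not vacuous and the induction can descend. If \<open>Q\<close> bounds the length, this
  rules out forcing from a board that is already too long.\<close>

lemma forces_reachable:
  assumes "forces Q G" "proper G" "legal_painter P"
  shows "\<exists>G'. length G \<le> length G' \<and> Q G'"
  using assms(1,2)
proof induction
  case (forces_now G)
  then show ?case by blast
next
  case (forces_step e G)
  then have "proper (G @ [(e, P G e)])"
    using assms(3) by (simp add: legal_painter_def)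
  then obtain G' where "length (G @ [(e, P G e)]) \<le> length G'" "Q G'"
    using forces_step.IH by blast
  then show ?case by (intro exI[of _ G']) simp
qed

text \<open>Builder always picks some edge that preserves \<open>forces\<close>. This choice need
  not follow any one derivation; termination comes from the length bound inside the forced
  property.\<close>

lemma builder_wins_within_if_forces:
  assumes "forces (\<lambda>G. has_rainbow_copy H G \<and> length G \<le> t) []"
  shows "builder_wins_within H t"
proof -
  let ?Q = "\<lambda>G. has_rainbow_copy H G \<and> length G \<le> t"
  let ?good = "\<lambda>G e. is_edge e \<and> (\<forall>c. proper (G @ [(e, c)]) \<longrightarrow> forces ?Q (G @ [(e, c)]))"
  \<comment> \<open>The default \<open>{0, 1}\<close> keeps Builder legal on boards from which
    nothing can be forced.\<close>
  define B :: builder where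
    "B G = (if \<exists>e. ?good G e then SOME e. ?good G e else {0, 1})" for G
  have good: "?good G (B G)" if "\<exists>e. ?good G e" for G
    using someI_ex[OF that] that unfolding B_def by simp
  have edge: "is_edge (B G)" for G
  proof (cases "\<exists>e. ?good G e")
    case True
    then show ?thesis using good by blast
  next
    case False
    then have "B G = {0, 1}" unfolding B_def by (rule if_not_P)
    then show ?thesis by (simp add: is_edge_def)
  qed
  have "\<exists>n\<le>t. has_rainbow_copy H (play B P n)" if P: "legal_painter P" for P
  proof (rule ccontr)
    assume none: "\<not> ?thesis"
    have len: "length (play B P n) = n" for n
      by (induction n) (auto simp: Let_def)
    have pr: "proper (play B P n)" for n
    proof (induction n)
      case 0
      then show ?case by (simp add: proper_def)
    next
      case (Suc n)
      then show ?case using P edge by (simp add: legal_painter_def Let_def)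
    qed
    \<comment> \<open>The invariant is carried one move past \<open>t\<close>: there the board has
      length \<open>Suc t\<close>, so the property it forces, which includes length at most
      \<open>t\<close>, is out of reach.\<close>
    have "forces ?Q (play B P n)" if "n \<le> Suc t" for n
      using that
    proof (induction n)
      case 0
      then show ?case using assms by simp
    next
      case (Suc n)
      then have "forces ?Q (play B P n)" by simp
      then have "\<exists>e. ?good (play B P n) e"
      proof cases
        case forces_now
        then show ?thesis using none Suc.prems by auto
      next
        case (forces_step e)
        then show ?thesis by blast
      qed
      from good[OF this] show ?case
        using pr[of "Suc n"] by (simp add: Let_def)
    qed
    from forces_reachable[OF this[OF le_refl] pr P] show False
      unfolding len by (meson Suc_n_not_le_n order_trans)
  qed
  then show ?thesis
    using edge unfolding builder_wins_within_def legal_builder_def by blast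
qed

section \<open>Rainbow matchings\<close>

text \<open>Pairs of ends and colour stand in for board positions: on a proper board of two-element
  edges such a pair determines its edge. Positions are chosen only when a copy is extracted.\<close>

definition rainbow_matching :: "(nat set \<times> nat) set \<Rightarrow> bool" where
  "rainbow_matching M \<longleftrightarrow> finite M \<and> (\<forall>p\<in>M. is_edge (fst p)) \<and>
     (\<forall>p\<in>M. \<forall>q\<in>M. p \<noteq> q \<longrightarrow> fst p \<inter> fst q = {} \<and> snd p \<noteq> snd q)"

lemma rainbow_matching_insert:
  assumes "rainbow_matching M" "is_edge e" "e \<inter> \<Union> (fst ` M) = {}" "c \<notin> snd ` M"
  shows "rainbow_matching (insert (e, c) M)" "card (insert (e, c) M) = Suc (card M)"
proof -
  have "(e, c) \<notin> M" using assms(4) by force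
  then show "card (insert (e, c) M) = Suc (card M)"
    using assms(1) by (simp add: rainbow_matching_def)
  have "e \<inter> fst p = {} \<and> c \<noteq> snd p" if "p \<in> M" for p
    using assms(3,4) that by blast
  then show "rainbow_matching (insert (e, c) M)"
    using assms(1,2) unfolding rainbow_matching_def by (simp add: Int_commute) metis
qed

lemma rainbow_matching_subset:
  "rainbow_matching M \<Longrightarrow> N \<subseteq> M \<Longrightarrow> rainbow_matching N"
  unfolding rainbow_matching_def by (meson finite_subset subsetD)

lemma finite_colours: "rainbow_matching M \<Longrightarrow> finite (snd ` M)"
  by (simp add: rainbow_matching_def)

lemma card_colours: "rainbow_matching M \<Longrightarrow> card (snd ` M) = card M"
  unfolding rainbow_matching_def by (intro card_image inj_onI) blast

lemma finite_vertices: "rainbow_matching M \<Longrightarrow> finite (\<Union> (fst ` M))"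
  unfolding rainbow_matching_def is_edge_def by (intro finite_Union) (auto intro!: card_ge_0_finite)

text \<open>Enumerate \<open>M\<close> by \<open>h\<close>, send the vertices \<open>2 * i\<close>
  and \<open>2 * i + 1\<close> to the two ends of \<open>h i\<close>, and choose one board position
  for each \<open>h i\<close>.\<close>

lemma has_rainbow_copy_if_rainbow_matching:
  assumes M: "rainbow_matching M" and sub: "M \<subseteq> set G" and k: "card M = k"
  shows "has_rainbow_copy (matching_graph k) G"
proof -
  have fin: "finite M" using M by (simp add: rainbow_matching_def)
  obtain h where h: "bij_betw h {..<k} M"
    using ex_bij_betw_nat_finite[OF fin] k by (auto simp: atLeast0LessThan)
  have hM: "h i \<in> M" if "i < k" for i using h that by (auto simp: bij_betw_def)
  have h_eq: "i = j" if "h i = h j" "i < k" "j < k" for i j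
    using h that by (auto simp: bij_betw_def inj_on_def)
  have "\<exists>a b. a \<noteq> b \<and> fst (h i) = {a, b}" if "i < k" for i
    using hM[OF that] M unfolding rainbow_matching_def is_edge_def card_2_iff by blast
  then obtain a b where ab: "\<And>i. i < k \<Longrightarrow> a i \<noteq> b i \<and> fst (h i) = {a i, b i}"
    by metis
  have "\<exists>j<length G. G ! j = h i" if "i < k" for i
    using hM[OF that] sub by (metis in_set_conv_nth subsetD)
  then obtain pos where pos: "\<And>i. i < k \<Longrightarrow> pos i < length G \<and> G ! pos i = h i"
    by metis
  define f where "f n = (if even n then a (n div 2) else b (n div 2))" for n :: nat
  \<comment> \<open>\<open>Min e div 2\<close> recovers the index \<open>i\<close> from the edge
    \<open>{2 * i, 2 * i + 1}\<close>.\<close>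
  define g where "g e = pos (Min e div 2)" for e :: "nat set"
  define E where "E = {{2 * i, 2 * i + 1} |i. i < k}"
  have g: "g {2 * i, 2 * i + 1} = pos i" for i by (simp add: g_def)
  have fe: "f ` {2 * i, 2 * i + 1} = {a i, b i}" for i by (auto simp: f_def)
  have disj: "{a i, b i} \<inter> {a j, b j} = {}" if "i < k" "j < k" "i \<noteq> j" for i j
    using M hM[of i] hM[of j] ab[of i] ab[of j] h_eq[of i j] that
    unfolding rainbow_matching_def by metis
  have "inj_on f {..<2 * k}"
  proof (rule inj_onI)
    fix x y assume x: "x \<in> {..<2 * k}" and y: "y \<in> {..<2 * k}" and eq: "f x = f y"
    have lt: "x div 2 < k" "y div 2 < k" using x y by auto
    have "x div 2 = y div 2"
      using disj[OF lt] eq by (auto simp: f_def split: if_splits)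
    moreover from this have "even x \<longleftrightarrow> even y"
      using ab[OF lt(1)] eq by (auto simp: f_def split: if_splits)
    ultimately show "x = y" by presburger
  qed
  then have bf: "bij_betw f {..<2 * k} (f ` {..<2 * k})" by (rule inj_on_imp_bij_betw)
  have pos_eq: "i = j" if "pos i = pos j" "i < k" "j < k" for i j
    using pos[of i] pos[of j] h_eq[of i j] that by metis
  have "inj_on g E"
    unfolding E_def by (rule inj_onI) (use g pos_eq in force)
  then have bg: "bij_betw g E (g ` E)" by (rule inj_on_imp_bij_betw)
  have "E = (\<lambda>i. {2 * i, 2 * i + 1}) ` {..<k}" unfolding E_def by blast
  then have gE: "g ` E = pos ` {..<k}" by (simp only: image_image g)
  have ends: "ends G (pos i) = f ` {2 * i, 2 * i + 1}" if "i < k" for i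
    using pos[OF that] ab[OF that] fe by (simp add: ends_def)
  have "is_copy (matching_graph k) G (f ` {..<2 * k}) (g ` E)"
    unfolding is_copy_def
  proof (intro conjI)
    show "g ` E \<subseteq> {..<length G}" using gE pos by auto
    show "\<forall>i\<in>g ` E. ends G i \<subseteq> f ` {..<2 * k}"
      unfolding gE using ends by auto
    show "\<exists>f' g'. bij_betw f' (fst (matching_graph k)) (f ` {..<2 * k}) \<and>
        bij_betw g' (snd (matching_graph k)) (g ` E) \<and>
        (\<forall>e\<in>snd (matching_graph k). ends G (g' e) = f' ` e)"
    proof (intro exI conjI)
      show "bij_betw f (fst (matching_graph k)) (f ` {..<2 * k})"
        using bf by (simp add: matching_graph_def)
      show "bij_betw g (snd (matching_graph k)) (g ` E)"
        using bg by (simp add: matching_graph_def E_def)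
      show "\<forall>e\<in>snd (matching_graph k). ends G (g e) = f ` e"
        using ends g by (auto simp: matching_graph_def)
    qed
  qed
  moreover have "rainbow G (g ` E)"
    unfolding rainbow_def gE
  proof (intro inj_onI; clarify)
    fix i j assume ij: "i < k" "j < k" and "colour G (pos i) = colour G (pos j)"
    then have "snd (h i) = snd (h j)" using pos by (simp add: colour_def)
    then have "h i = h j" using M hM ij unfolding rainbow_matching_def by blast
    then show "pos i = pos j" using h_eq ij by blast
  qed
  ultimately show ?thesis unfolding has_rainbow_copy_def by blast
qed

section \<open>Bundles of parallel edges\<close>

definition colours_at :: "board \<Rightarrow> nat \<Rightarrow> nat set" where
  "colours_at G x = {c. \<exists>e. (e, c) \<in> set G \<and> x \<in> e}"

lemma colours_at_mono: "set G \<subseteq> set G' \<Longrightarrow> colours_at G x \<subseteq> colours_at G' x"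
  unfolding colours_at_def by blast

lemma proper_snoc_not_in_colours_at:
  assumes "proper (G @ [(e, c)])" "x \<in> e"
  shows "c \<notin> colours_at G x"
proof
  assume "c \<in> colours_at G x"
  then obtain e' i where i: "i < length G" "G ! i = (e', c)" "x \<in> e'"
    unfolding colours_at_def by (auto simp: in_set_conv_nth)
  then show False
    using assms(1)[unfolded proper_def ends_def colour_def, rule_format, of i "length G"] assms(2)
    by (auto simp: nth_append)
qed

text \<open>Each parallel edge needs a colour not yet seen at \<open>x\<close>, so an answer in
  \<open>K\<close> uses up one of the at most \<open>card K - n\<close> colours of \<open>K\<close>
  still missing there; one further edge gets a colour outside \<open>K\<close>. The bound is written
  additively to avoid truncated subtraction.\<close>

lemma forces_new_colour:
  assumes "finite K" "x \<noteq> y" "proper G" "n \<le> card (K \<inter> colours_at G x)"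
  shows "forces (\<lambda>G'. set G \<subseteq> set G' \<and> (\<exists>c. c \<notin> K \<and> ({x, y}, c) \<in> set G') \<and>
           length G' + n \<le> length G + card K + 1) G"
  using assms(3,4)
proof (induction "card K - n" arbitrary: G n rule: less_induct)
  case less
  have nK: "n \<le> card K"
    using less.prems(2) card_mono[OF assms(1), of "K \<inter> colours_at G x"] by simp
  show ?case
  proof (rule forces_step)
    show "is_edge {x, y}" using assms(2) by (simp add: is_edge_def)
    fix c assume pr: "proper (G @ [({x, y}, c)])"
    let ?G = "G @ [({x, y}, c)]"
    show "forces (\<lambda>G'. set G \<subseteq> set G' \<and> (\<exists>c. c \<notin> K \<and> ({x, y}, c) \<in> set G') \<and>
           length G' + n \<le> length G + card K + 1) ?G"
    proof (cases "c \<in> K")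
      case False
      then show ?thesis using nK by (intro forces_now) auto
    next
      case True
      have c: "c \<notin> colours_at G x" using proper_snoc_not_in_colours_at[OF pr] by simp
      have "insert c (K \<inter> colours_at G x) \<subseteq> K \<inter> colours_at ?G x"
        using True by (auto simp: colours_at_def)
      from card_mono[OF _ this] c assms(1)
      have 1: "Suc (card (K \<inter> colours_at G x)) \<le> card (K \<inter> colours_at ?G x)" by simp
      have "card (K \<inter> colours_at ?G x) \<le> card K" using assms(1) by (simp add: card_mono)
      then have 2: "card K - Suc n < card K - n" using 1 less.prems(2) by linarith
      show ?thesis
        by (rule forces_mono[OF less.hyps[OF 2 pr]]) (use 1 less.prems(2) pr in auto)
    qed
  qed
qed

text \<open>If no new colour appears, the bundle uses \<open>n\<close> colours of \<open>K\<close>,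
  all unseen at both ends beforehand. This disjointness is what later lets the colours of two
  triangle sides add up at their common vertex.\<close>

lemma forces_bundle:
  assumes "x \<noteq> y" "proper G"
  shows "forces (\<lambda>G'. set G \<subseteq> set G' \<and> length G' \<le> length G + n \<and>
           ((\<exists>c. c \<notin> K \<and> ({x, y}, c) \<in> set G') \<or>
            (\<exists>A\<subseteq>K. finite A \<and> card A = n \<and> (\<forall>c\<in>A. ({x, y}, c) \<in> set G') \<and>
               A \<inter> (colours_at G x \<union> colours_at G y) = {}))) G"
  using assms(2)
proof (induction n arbitrary: G)
  case 0
  show ?case by (intro forces_now) auto
next
  case (Suc n)
  show ?case
  proof (rule forces_step)
    show "is_edge {x, y}" using assms(1) by (simp add: is_edge_def)
    fix c assume pr: "proper (G @ [({x, y}, c)])"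
    let ?G = "G @ [({x, y}, c)]"
    have c: "c \<notin> colours_at G x" "c \<notin> colours_at G y"
      using proper_snoc_not_in_colours_at[OF pr] by auto
    \<comment> \<open>The remaining edges avoid all colours at \<open>x\<close> on the extended
      board, in particular \<open>c\<close>; hence \<open>insert c A\<close> has
      \<open>Suc n\<close> elements.\<close>
    have c': "c \<in> colours_at ?G x" by (auto simp: colours_at_def)
    have mono: "colours_at G z \<subseteq> colours_at ?G z" for z by (rule colours_at_mono) auto
    show "forces (\<lambda>G'. set G \<subseteq> set G' \<and> length G' \<le> length G + Suc n \<and>
           ((\<exists>c. c \<notin> K \<and> ({x, y}, c) \<in> set G') \<or>
            (\<exists>A\<subseteq>K. finite A \<and> card A = Suc n \<and> (\<forall>c\<in>A. ({x, y}, c) \<in> set G') \<and>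
               A \<inter> (colours_at G x \<union> colours_at G y) = {}))) ?G"
    proof (rule forces_mono[OF Suc.IH[OF pr] pr], goal_cases)
      case (1 G')
      show ?case
      proof (cases "c \<in> K \<and> \<not> (\<exists>c. c \<notin> K \<and> ({x, y}, c) \<in> set G')")
        case False
        then show ?thesis using 1 by auto
      next
        case True
        then obtain A where A: "A \<subseteq> K" "finite A" "card A = n" "\<forall>c\<in>A. ({x, y}, c) \<in> set G'"
          "A \<inter> (colours_at ?G x \<union> colours_at ?G y) = {}"
          using 1 by blast
        have "insert c A \<subseteq> K" using A True by blast
        moreover have "finite (insert c A)" using A by simp
        moreover have "card (insert c A) = Suc n" using A c' by (auto simp: card_insert_if)
        moreover have "\<forall>c\<in>insert c A. ({x, y}, c) \<in> set G'" using A 1 by simp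
        moreover have "insert c A \<inter> (colours_at G x \<union> colours_at G y) = {}"
          using A(5) c mono by blast
        ultimately have "\<exists>A\<subseteq>K. finite A \<and> card A = Suc n \<and>
            (\<forall>c\<in>A. ({x, y}, c) \<in> set G') \<and>
            A \<inter> (colours_at G x \<union> colours_at G y) = {}" by blast
        then show ?thesis using 1 by simp
      qed
    qed
  qed
qed

section \<open>Builder's strategy\<close>

definition matching_within :: "nat \<Rightarrow> nat \<Rightarrow> board \<Rightarrow> bool" where
  "matching_within i t G \<longleftrightarrow>
     (\<exists>M. rainbow_matching M \<and> M \<subseteq> set G \<and> card M = i) \<and> length G \<le> t"

text \<open>As \<open>x\<close> and \<open>y\<close> lie off \<open>M\<close>, any new colour on the
  edge between them extends \<open>M\<close>. Each colour of \<open>M\<close> already present at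
  \<open>x\<close> saves one edge.\<close>

lemma forces_pendant:
  assumes M: "rainbow_matching M" "M \<subseteq> set G" and G: "proper G"
    and xy: "x \<noteq> y" "x \<notin> \<Union> (fst ` M)" "y \<notin> \<Union> (fst ` M)"
    and n: "n \<le> card (snd ` M \<inter> colours_at G x)"
  shows "forces (\<lambda>G'. set G \<subseteq> set G' \<and> length G' + n \<le> length G + card M + 1 \<and>
           (\<exists>c. c \<notin> snd ` M \<and> rainbow_matching (insert ({x, y}, c) M) \<and>
              insert ({x, y}, c) M \<subseteq> set G' \<and>
              card (insert ({x, y}, c) M) = Suc (card M))) G"
proof (rule forces_mono[OF forces_new_colour[OF finite_colours[OF M(1)] xy(1) G n] G], goal_cases)
  case (1 G')
  then obtain c where c: "c \<notin> snd ` M" "({x, y}, c) \<in> set G'" by blast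
  have "is_edge {x, y}" "{x, y} \<inter> \<Union> (fst ` M) = {}" using xy by (auto simp: is_edge_def)
  from rainbow_matching_insert[OF M(1) this c(1)] show ?case
    using c 1 M by (intro conjI exI[of _ c]) (auto simp: card_colours)
qed

text \<open>\<open>A\<close> and \<open>B\<close> are meant as the colours on the two triangle sides
  at \<open>x\<close>. The count is stated for larger \<open>G'\<close> and \<open>K'\<close> so
  that it survives later moves and the growth of the matching.\<close>

lemma card_colours_at_ge:
  assumes "A \<subseteq> K" "B \<subseteq> K" "finite A" "finite B" "finite K" "A \<inter> B = {}"
    and "A \<subseteq> colours_at G x" "B \<subseteq> colours_at G x" "set G \<subseteq> set G'" "K \<subseteq> K'" "finite K'"
  shows "card A + card B \<le> card (K' \<inter> colours_at G' x)"
proof -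
  have "A \<union> B \<subseteq> K' \<inter> colours_at G' x"
    using assms colours_at_mono[OF assms(9)] by blast
  from card_mono[OF _ this] show ?thesis using assms by (simp add: card_Un_disjoint)
qed

lemma exists_fresh_list:
  assumes "finite (V :: nat set)"
  shows "\<exists>xs. length xs = n \<and> distinct xs \<and> set xs \<inter> V = {}"
proof (induction n)
  case 0
  show ?case by simp
next
  case (Suc n)
  then obtain xs where xs: "length xs = n" "distinct xs" "set xs \<inter> V = {}" by blast
  obtain x where "x \<notin> V \<union> set xs"
    using ex_new_if_finite[of "V \<union> set xs"] assms by auto
  then show ?case using xs by (intro exI[of _ "x # xs"]) auto
qed

text \<open>The corners of the triangle and a pendant end for each of them.\<close>

lemma exists_fresh6:
  assumes "finite (V :: nat set)"
  obtains u v w u' v' w' where "distinct [u, v, w, u', v', w']"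
    "{u, v, w, u', v', w'} \<inter> V = {}"
proof -
  obtain xs where xs: "length xs = 6" "distinct xs" "set xs \<inter> V = {}"
    using exists_fresh_list[OF assms] by blast
  then obtain u v w u' v' w' where "xs = [u, v, w, u', v', w']"
    by (auto simp: numeral_eq_Suc length_Suc_conv)
  then show ?thesis using xs that by simp
qed

text \<open>The choice of \<open>m\<close> balances the three outcomes: the costs per gained edge
  are about \<open>2 * m\<close>, \<open>(i + m) / 2\<close> and \<open>i - m\<close>, and all equal
  \<open>2 * i / 3\<close> when \<open>m\<close> is \<open>i / 3\<close>.\<close>

lemma forces_larger_matching:
  assumes M: "rainbow_matching M" "M \<subseteq> set G" and G: "proper G"
    and i: "card M = i" and m: "m = i div 3" and l: "length G = l"
  shows "forces (\<lambda>G'. matching_within (i + 1) (l + 2 * m) G' \<or>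
           matching_within (i + 2) (l + i + m + 2) G' \<or>
           matching_within (i + 3) (l + 3 * i + 6 - 3 * m) G') G" (is "forces ?Q G")
proof -
  define K where "K = snd ` M"
  have K: "finite K" "card K = i"
    using M i finite_colours card_colours by (auto simp: K_def)
  obtain u v w u' v' w' where dist: "distinct [u, v, w, u', v', w']"
    and fresh: "{u, v, w, u', v', w'} \<inter> \<Union> (fst ` M) = {}"
    using exists_fresh6[OF finite_vertices[OF M(1)]] by metis
  have ins: "rainbow_matching (insert ({x, y}, c) M)"
    "card (insert ({x, y}, c) M) = Suc i"
    if "x \<in> {u, v, w}" "y \<in> {u, v, w}" "x \<noteq> y" "c \<notin> K" for x y c
    using rainbow_matching_insert[OF M(1), of "{x, y}" c] that fresh i
    by (auto simp: is_edge_def K_def)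
  \<comment> \<open>Covers a new colour on either of the first two sides, when at most two bundles
    have been drawn.\<close>
  have gain1: "?Q G'" if "({x, y}, c) \<in> set G'" "x \<in> {u, v, w}" "y \<in> {u, v, w}" "x \<noteq> y" "c \<notin> K"
    "set G \<subseteq> set G'" "length G' \<le> l + 2 * m" for x y c G'
    using ins[of x y c] that M unfolding matching_within_def
    by (intro disjI1 conjI exI[of _ "insert ({x, y}, c) M"]) auto
  note uv = forces_bundle[of u v G m K, OF _ G]
  show ?thesis
  proof (rule forces_bind[OF uv G], goal_cases)
    case 1 show ?case using dist by simp
  next
    case (2 G1)
    note G1 = this
    show ?case
    proof (cases "\<exists>c. c \<notin> K \<and> ({u, v}, c) \<in> set G1")
      case True
      then show ?thesis using gain1[of u v _ G1] G1 dist l by (intro forces_now) auto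
    next
      case False
      then obtain A where A: "A \<subseteq> K" "finite A" "card A = m" "\<forall>c\<in>A. ({u, v}, c) \<in> set G1"
        using G1 by blast
      have Au: "A \<subseteq> colours_at G1 u" and Av: "A \<subseteq> colours_at G1 v"
        using A(4) by (auto simp: colours_at_def)
      show ?thesis
      proof (rule forces_bind[OF forces_bundle[of v w G1 m K, OF _ G1(1)] G1(1)], goal_cases)
        case 1 show ?case using dist by simp
      next
        case (2 G2)
        note G2 = this
        have sub2: "set G \<subseteq> set G2" using G1 G2 by blast
        show ?case
        proof (cases "\<exists>c. c \<notin> K \<and> ({v, w}, c) \<in> set G2")
          case True
          then show ?thesis using gain1[of v w _ G2] G1 G2 sub2 dist l by (intro forces_now) auto
        next
          case False
          then obtain B where B: "B \<subseteq> K" "finite B" "card B = m" "\<forall>c\<in>B. ({v, w}, c) \<in> set G2"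
            "B \<inter> (colours_at G1 v \<union> colours_at G1 w) = {}"
            using G2 by blast
          \<comment> \<open>The colours in \<open>A\<close> were already at the shared vertex
            \<open>v\<close> when the second bundle was drawn, so that bundle had to avoid
            them.\<close>
          have AB: "A \<inter> B = {}" using Av B(5) by blast
          have Bv: "B \<subseteq> colours_at G2 v" and Bw: "B \<subseteq> colours_at G2 w"
            using B(4) by (auto simp: colours_at_def)
          have A2: "A \<subseteq> colours_at G2 u" "A \<subseteq> colours_at G2 v"
            using Au Av colours_at_mono[of G1 G2] G2 by blast+
          \<comment> \<open>Kept general in \<open>G'\<close> and \<open>K'\<close> because it
            serves two branches: after a gain on \<open>u w\<close>, and after a pendant gain at
            \<open>u\<close>.\<close>
          have at_v: "2 * m \<le> card (K' \<inter> colours_at G' v)"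
            if "set G2 \<subseteq> set G'" "K \<subseteq> K'" "finite K'" for G' K'
            using card_colours_at_ge[OF A(1) B(1) A(2) B(2) K(1) AB A2(2) Bv that] A(3) B(3) by simp
          show ?thesis
          proof (rule forces_bind[OF forces_bundle[of u w G2 m K, OF _ G2(1)] G2(1)], goal_cases)
            case 1 show ?case using dist by simp
          next
            case (2 G3)
            note G3 = this
            have sub3: "set G \<subseteq> set G3" using sub2 G3 by blast
            have len3: "length G3 \<le> l + 3 * m" using G1 G2 G3 l by simp
            show ?case
            proof (cases "\<exists>c. c \<notin> K \<and> ({u, w}, c) \<in> set G3")
              case True
              then obtain c where c: "c \<notin> K" "({u, w}, c) \<in> set G3" by blast
              let ?M = "insert ({u, w}, c) M"
              have M1: "rainbow_matching ?M" "card ?M = Suc i" "?M \<subseteq> set G3"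
                using ins[of u w c] c dist M sub3 by auto
              \<comment> \<open>The gained edge \<open>u w\<close> misses \<open>v\<close>, so a
                pendant edge from \<open>v\<close> to \<open>v'\<close> can extend the enlarged
                matching. It costs at most \<open>(i + 1) + 1 - 2 * m\<close> edges on top of the
                \<open>3 * m\<close> of the triangle.\<close>
              show ?thesis
              proof (rule forces_mono[OF forces_pendant[OF M1(1,3) G3(1), of v v' "2 * m"] G3(1)],
                  goal_cases)
                case 4
                show ?case using at_v[of G3 "snd ` ?M"] G3 finite_colours[OF M1(1)]
                  by (auto simp: K_def)
              next
                case (5 G')
                then show ?case using len3 M1(2) m unfolding matching_within_def by auto
              qed (use dist fresh in auto)
            next
              case False
              then obtain C where C: "C \<subseteq> K" "finite C" "card C = m"
                "\<forall>c\<in>C. ({u, w}, c) \<in> set G3" "C \<inter> (colours_at G2 u \<union> colours_at G2 w) = {}"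
                using G3 by blast
              have AC: "A \<inter> C = {}" and BC: "B \<inter> C = {}" using A2 Bw C(5) by blast+
              have Cu: "C \<subseteq> colours_at G3 u" and Cw: "C \<subseteq> colours_at G3 w"
                using C(4) by (auto simp: colours_at_def)
              have A3: "A \<subseteq> colours_at G3 u" and B3: "B \<subseteq> colours_at G3 w"
                using A2 Bw colours_at_mono[of G2 G3] G3 by blast+
              have at_u: "2 * m \<le> card (K' \<inter> colours_at G' u)"
                if "set G3 \<subseteq> set G'" "K \<subseteq> K'" "finite K'" for G' K'
                using card_colours_at_ge[OF A(1) C(1) A(2) C(2) K(1) AC A3 Cu that] A(3) C(3)
                by simp
              have at_w: "2 * m \<le> card (K' \<inter> colours_at G' w)"
                if "set G3 \<subseteq> set G'" "K \<subseteq> K'" "finite K'" for G' K'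
                using card_colours_at_ge[OF B(1) C(1) B(2) C(2) K(1) BC B3 Cw that] B(3) C(3)
                by simp
              have M3: "M \<subseteq> set G3" using M sub3 by blast
              \<comment> \<open>Now every corner meets \<open>2 * m\<close> colours of
                \<open>M\<close>. The pendant edges at \<open>u\<close>, \<open>v\<close>,
                \<open>w\<close> go to distinct fresh ends, so each gain leaves the next corner
                free.\<close>
              show ?thesis
              proof (rule forces_bind[OF forces_pendant[OF M(1) M3 G3(1), of u u' "2 * m"] G3(1)],
                  goal_cases)
                case 4
                show ?case using at_u[of G3 K] K by (simp add: K_def)
              next
                case (5 G4)
                note G4 = this
                then obtain c where M4: "rainbow_matching (insert ({u, u'}, c) M)"
                  "insert ({u, u'}, c) M \<subseteq> set G4" "card (insert ({u, u'}, c) M) = Suc i"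
                  using i by auto
                let ?M = "insert ({u, u'}, c) M"
                show ?case
                proof (rule forces_bind[OF
                      forces_pendant[OF M4(1,2) G4(1), of v v' "2 * m"] G4(1)], goal_cases)
                  case 4
                  show ?case using at_v[of G4 "snd ` ?M"] G3 G4 finite_colours[OF M4(1)]
                    by (auto simp: K_def)
                next
                  case (5 G5)
                  note G5 = this
                  then obtain d where M5: "rainbow_matching (insert ({v, v'}, d) ?M)"
                    "insert ({v, v'}, d) ?M \<subseteq> set G5"
                    "card (insert ({v, v'}, d) ?M) = Suc (Suc i)"
                    using M4(3) by auto
                  let ?M' = "insert ({v, v'}, d) ?M"
                  show ?case
                  proof (rule forces_mono[OF
                        forces_pendant[OF M5(1,2) G5(1), of w w' "2 * m"] G5(1)], goal_cases)
                    case 4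
                    show ?case
                      using at_w[of G5 "snd ` ?M'"] G4 G5 finite_colours[OF M5(1)]
                      by (auto simp: K_def)
                  next
                    case (5 G6)
                    then obtain N where "rainbow_matching N" "N \<subseteq> set G6" "card N = i + 3"
                      using M5(3) by (auto simp: numeral_3_eq_3)
                    \<comment> \<open>The pendant bundles face matchings of sizes \<open>i\<close>,
                      \<open>i + 1\<close>, \<open>i + 2\<close> and cost at most
                      \<open>3 * i + 6 - 6 * m\<close> together; the triangle adds
                      \<open>3 * m\<close>.\<close>
                    moreover have "length G6 \<le> l + 3 * i + 6 - 3 * m"
                      using 5 G5 G4 len3 i M4(3) M5(3) by linarith
                    ultimately show ?case unfolding matching_within_def by blast
                  qed (use dist fresh in auto)
                qed (use dist fresh in auto)
              qed (use dist fresh in auto)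
            qed
          qed
        qed
      qed
    qed
  qed
qed

section \<open>Summing the costs of the enlargement steps\<close>

text \<open>The coefficient 5 absorbs rounding. From \<open>i \<le> 3 * (i div 3) + 2\<close>, three
  times the cost of a gain of three edges is at most \<open>6 * i + 24\<close>, which is exactly the
  increase of \<open>i\<^sup>2 + 5 * i\<close> from \<open>i\<close> to
  \<open>i + 3\<close>.\<close>

definition cheap_matching :: "nat \<Rightarrow> board \<Rightarrow> bool" where
  "cheap_matching i G \<longleftrightarrow>
     (\<exists>M. rainbow_matching M \<and> M \<subseteq> set G \<and> card M = i) \<and> 3 * length G \<le> i\<^sup>2 + 5 * i"

lemma forces_cheap_step:
  assumes "cheap_matching i G" "proper G"
  shows "forces (\<lambda>G'. \<exists>j. i < j \<and> j \<le> i + 3 \<and> cheap_matching j G') G"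
proof -
  obtain M where M: "rainbow_matching M" "M \<subseteq> set G" "card M = i"
    and l: "3 * length G \<le> i\<^sup>2 + 5 * i"
    using assms(1) unfolding cheap_matching_def by blast
  have m: "3 * (i div 3) \<le> i" "i \<le> 3 * (i div 3) + 2" by linarith+
  show ?thesis
  proof (rule forces_mono[OF forces_larger_matching[OF M(1,2) assms(2) M(3) refl refl] assms(2)],
      goal_cases)
    case (1 G')
    then consider "matching_within (i + 1) (length G + 2 * (i div 3)) G'"
      | "matching_within (i + 2) (length G + i + i div 3 + 2) G'"
      | "matching_within (i + 3) (length G + 3 * i + 6 - 3 * (i div 3)) G'"
      by blast
    then show ?case
    proof cases
      case 1
      then have "cheap_matching (i + 1) G'"
        using l m unfolding matching_within_def cheap_matching_def
        by (auto simp: power2_eq_square algebra_simps)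
      then show ?thesis by (intro exI[of _ "i + 1"]) simp
    next
      case 2
      then have "cheap_matching (i + 2) G'"
        using l m unfolding matching_within_def cheap_matching_def
        by (auto simp: power2_eq_square algebra_simps)
      then show ?thesis by (intro exI[of _ "i + 2"]) simp
    next
      case 3
      then have "cheap_matching (i + 3) G'"
        using l m unfolding matching_within_def cheap_matching_def
        by (auto simp: power2_eq_square algebra_simps)
      then show ?thesis by (intro exI[of _ "i + 3"]) simp
    qed
  qed
qed

text \<open>A step gains up to three edges, so the last step, starting below \<open>k\<close>, may
  overshoot \<open>k\<close> by two.\<close>

lemma forces_cheap_matching:
  assumes "cheap_matching i G" "proper G" "i \<le> k + 2"
  shows "forces (\<lambda>G'. \<exists>j. k \<le> j \<and> j \<le> k + 2 \<and> cheap_matching j G') G"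
  using assms
proof (induction "k - i" arbitrary: i G rule: less_induct)
  case less
  show ?case
  proof (cases "k \<le> i")
    case True
    then show ?thesis using less.prems by (intro forces_now) auto
  next
    case False
    show ?thesis
    proof (rule forces_bind[OF forces_cheap_step[OF less.prems(1,2)] less.prems(2)])
      fix G' assume G': "proper G'" "\<exists>j. i < j \<and> j \<le> i + 3 \<and> cheap_matching j G'"
      then obtain j where "i < j" "j \<le> i + 3" "cheap_matching j G'" by blast
      then show "forces (\<lambda>G'. \<exists>j. k \<le> j \<and> j \<le> k + 2 \<and> cheap_matching j G') G'"
        using less.hyps[of j G'] G'(1) False by auto
    qed
  qed
qed

lemma builder_wins_matching:
  "builder_wins_within (matching_graph k) (((k + 2)\<^sup>2 + 5 * (k + 2)) div 3)"
proof (rule builder_wins_within_if_forces)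
  have nil: "proper []" by (simp add: proper_def)
  have "cheap_matching 0 []"
    unfolding cheap_matching_def rainbow_matching_def by auto
  from forces_cheap_matching[OF this nil]
  have "forces (\<lambda>G'. \<exists>j. k \<le> j \<and> j \<le> k + 2 \<and> cheap_matching j G') []" by simp
  then show "forces (\<lambda>G. has_rainbow_copy (matching_graph k) G \<and>
      length G \<le> ((k + 2)\<^sup>2 + 5 * (k + 2)) div 3) []"
  proof (rule forces_mono[OF _ nil])
    fix G assume "\<exists>j. k \<le> j \<and> j \<le> k + 2 \<and> cheap_matching j G"
    then obtain j M where j: "k \<le> j" "j \<le> k + 2" and l: "3 * length G \<le> j\<^sup>2 + 5 * j"
      and M: "rainbow_matching M" "M \<subseteq> set G" "card M = j"
      unfolding cheap_matching_def by blast
    \<comment> \<open>The surplus edges of an overshoot are discarded; their cost stays in the bound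
      through \<open>k + 2\<close>.\<close>
    obtain N where N: "N \<subseteq> M" "card N = k"
      using obtain_subset_with_card_n[of k M] j(1) M(3) by blast
    have "has_rainbow_copy (matching_graph k) G"
      using has_rainbow_copy_if_rainbow_matching[OF rainbow_matching_subset[OF M(1) N(1)] _ N(2)]
        N M by blast
    moreover have "j\<^sup>2 \<le> (k + 2)\<^sup>2" using j by (intro power_mono) auto
    then have "3 * length G \<le> (k + 2)\<^sup>2 + 5 * (k + 2)"
      using order_trans[OF l add_mono] j(2) by simp
    then have "length G \<le> ((k + 2)\<^sup>2 + 5 * (k + 2)) div 3" by linarith
    ultimately show "has_rainbow_copy (matching_graph k) G \<and>
        length G \<le> ((k + 2)\<^sup>2 + 5 * (k + 2)) div 3"
      by blast
  qed
qed

theorem theorem18: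
  "\<exists>C::real. \<forall>k::nat. k \<ge> 1 \<longrightarrow>
     ereal_of_enat (AR_o_star (matching_graph k)) \<le> ereal ((real k)\<^sup>2 / 3 + C * real k)"
proof (intro exI[of _ 8] allI impI)
  fix k :: nat assume k: "k \<ge> 1"
  define t where "t = ((k + 2)\<^sup>2 + 5 * (k + 2)) div 3"
  have "AR_o_star (matching_graph k) \<le> enat t"
    unfolding AR_o_star_def t_def using builder_wins_matching by (intro Inf_lower) blast
  then have "ereal_of_enat (AR_o_star (matching_graph k)) \<le> ereal_of_enat (enat t)"
    by (simp only: ereal_of_enat_le_iff)
  also have "\<dots> = ereal (real t)" by simp
  also have "\<dots> \<le> ereal ((real k)\<^sup>2 / 3 + 8 * real k)"
  proof -
    have "3 * t \<le> (k + 2)\<^sup>2 + 5 * (k + 2)" unfolding t_def by simp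
    then have "real (3 * t) \<le> real ((k + 2)\<^sup>2 + 5 * (k + 2))" by (rule of_nat_mono)
    \<comment> \<open>The numerator \<open>(k + 2)\<^sup>2 + 5 * (k + 2)\<close> equals
      \<open>k\<^sup>2 + 9 * k + 14\<close>, and \<open>k \<ge> 1\<close> bounds it by
      \<open>k\<^sup>2 + 24 * k\<close>; dividing by 3 gives the constant 8.\<close>
    then show ?thesis using k by (simp add: power2_eq_square algebra_simps)
  qed
  finally show "ereal_of_enat (AR_o_star (matching_graph k)) \<le> ereal ((real k)\<^sup>2 / 3 + 8 * real k)" .
qed

end
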